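(* Let $(S,\circ)$ be a right loop with identity $e$, let $G_S$ be its right inner mapping group (group torsion), and for $x\in S$, $a\in G_S$, $r\in\mathbb{N}=\{1,2,\dots\}$ let $\beta^r(x,a)\in S$ and $g^r(x,a)\in G_S$ be the recursively defined elements given in the context. Let $x\in S\setminus\{e\}$, $a\in G_S\setminus\{I_S\}$ and $m,n\in\mathbb{N}$. Then in the general extension $G_S\times S$ one has $(a,x)^r=(g^r(x,a),\beta^r(x,a))$ for every $r\in\mathbb{N}$, and the keys $$K_A=\big(\beta^n(x,a)\,\theta\, g^m(x,a)\big)\circ\beta^m(x,a),\qquad K_B=\big(\beta^m(x,a)\,\theta\, g^n(x,a)\big)\circ\beta^n(x,a)$$ coincide: $K_A=K_B$.
   Context: A right loop is a set $S$ with a binary operation $\circ$ and a two-sided identity $e$ such that for all $x,y\in S$ the equation $X\circ x=y$ has a unique solution $X\in S$. For $y,z\in S$ the right inner mapping $f(y,z)$ is the permutation of $S$ (fixing $e$) determined by $f(y,z)(x)\circ(y\circ z)=(x\circ y)\circ z$ for all $x\in S$. $G_S$ is the subgroup of the group of permutations of $S$ fixing $e$ generated by all $f(y,z)$, and $I_S$ is the identity map of $S$. Write $x\theta h=h(x)$; products of permutations are taken so that $\theta$ is a right action: $x\theta(hk)=(x\theta h)\theta k$ (apply $h$ first). For a permutation $h$ of $S$ fixing $e$ and $y\in S$, $\sigma_y(h)$ is the permutation of $S$ fixing $e$ determined by $(x\circ y)\theta h=(x\theta\sigma_y(h))\circ(y\theta h)$ for all $x\in S$. It is known that $\sigma_y$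 maps $G_S$ to $G_S$ and that $G_S\times S$ is a group, called the general extension associated to $S$, under $$(a,x)\cdot(b,y)=\big(a\,\sigma_x(b)\,f(x\theta b,y),\ (x\theta b)\circ y\big).$$ For $x\in S$, $a\in G_S$ define recursively $\beta^1(x,a)=x$, $\beta^{r+1}(x,a)=(\beta^r(x,a)\theta a)\circ x$, and $g^1(x,a)=a$, $g^{r+1}(x,a)=g^r(x,a)\,\sigma_{\beta^r(x,a)}(a)\,f(\beta^r(x,a)\theta a,\,x)$. *)

theory Defs
  imports "HOL-Algebra.Bij" "HOL-Algebra.Generated_Groups"
begin

locale right_loop =
  fixes S (structure)
  assumes m_closed: "\<lbrakk>x \<in> carrier S; y \<in> carrier S\<rbrakk> \<Longrightarrow> x \<otimes> y \<in> carrier S"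
    and one_closed: "\<one> \<in> carrier S"
    and l_one: "x \<in> carrier S \<Longrightarrow> \<one> \<otimes> x = x"
    and r_one: "x \<in> carrier S \<Longrightarrow> x \<otimes> \<one> = x"
    and right_div: "\<lbrakk>x \<in> carrier S; y \<in> carrier S\<rbrakk> \<Longrightarrow> \<exists>!X. X \<in> carrier S \<and> X \<otimes> x = y"

text \<open>
  Permutations of the carrier are extensional functions (as in \<^const>\<open>Bij\<close>), so equality of
  permutations is equality of functions. The right action $x \theta h$ is the application \<open>h x\<close>,
  and the product \<open>h k\<close> applies \<open>h\<close> first, which is opposite to \<^const>\<open>BijGroup\<close>.
\<close>

definition perm_fix_group :: "('a, 'b) monoid_scheme \<Rightarrow> ('a \<Rightarrow> 'a) monoid" where
  "perm_fix_group S =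
    \<lparr>carrier = {h \<in> Bij (carrier S). h \<one>\<^bsub>S\<^esub> = \<one>\<^bsub>S\<^esub>},
     mult = (\<lambda>h k. compose (carrier S) k h),
     one = (\<lambda>x\<in>carrier S. x)\<rparr>"

definition inner_map :: "('a, 'b) monoid_scheme \<Rightarrow> 'a \<Rightarrow> 'a \<Rightarrow> 'a \<Rightarrow> 'a" where
  "inner_map S y z = (THE h. h \<in> carrier (perm_fix_group S) \<and>
    (\<forall>x\<in>carrier S. h x \<otimes>\<^bsub>S\<^esub> (y \<otimes>\<^bsub>S\<^esub> z) = (x \<otimes>\<^bsub>S\<^esub> y) \<otimes>\<^bsub>S\<^esub> z))"

definition group_torsion :: "('a, 'b) monoid_scheme \<Rightarrow> ('a \<Rightarrow> 'a) set" where
  "group_torsion S = generate (perm_fix_group S)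
    {inner_map S y z | y z. y \<in> carrier S \<and> z \<in> carrier S}"

definition sigma :: "('a, 'b) monoid_scheme \<Rightarrow> 'a \<Rightarrow> ('a \<Rightarrow> 'a) \<Rightarrow> 'a \<Rightarrow> 'a" where
  "sigma S y h = (THE k. k \<in> carrier (perm_fix_group S) \<and>
    (\<forall>x\<in>carrier S. h (x \<otimes>\<^bsub>S\<^esub> y) = k x \<otimes>\<^bsub>S\<^esub> h y))"

definition general_extension :: "('a, 'b) monoid_scheme \<Rightarrow> (('a \<Rightarrow> 'a) \<times> 'a) monoid" where
  "general_extension S =
    \<lparr>carrier = group_torsion S \<times> carrier S,
     mult = (\<lambda>(a, x) (b, y).
       (a \<otimes>\<^bsub>perm_fix_group S\<^esub> sigma S x b \<otimes>\<^bsub>perm_fix_group S\<^esub> inner_map S (b x) y,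
        b x \<otimes>\<^bsub>S\<^esub> y)),
     one = (\<one>\<^bsub>perm_fix_group S\<^esub>, \<one>\<^bsub>S\<^esub>)\<rparr>"

text \<open>The sequences below are indexed from 1; their values at index 0 carry no meaning.\<close>

fun beta :: "('a, 'b) monoid_scheme \<Rightarrow> nat \<Rightarrow> 'a \<Rightarrow> ('a \<Rightarrow> 'a) \<Rightarrow> 'a" where
  "beta S 0 x a = undefined"
| "beta S (Suc 0) x a = x"
| "beta S (Suc (Suc r)) x a = a (beta S (Suc r) x a) \<otimes>\<^bsub>S\<^esub> x"

fun gseq :: "('a, 'b) monoid_scheme \<Rightarrow> nat \<Rightarrow> 'a \<Rightarrow> ('a \<Rightarrow> 'a) \<Rightarrow> 'a \<Rightarrow> 'a" where
  "gseq S 0 x a = undefined"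
| "gseq S (Suc 0) x a = a"
| "gseq S (Suc (Suc r)) x a =
    gseq S (Suc r) x a
    \<otimes>\<^bsub>perm_fix_group S\<^esub> sigma S (beta S (Suc r) x a) a
    \<otimes>\<^bsub>perm_fix_group S\<^esub> inner_map S (a (beta S (Suc r) x a)) x"

text \<open>
  In a right loop \<^const>\<open>perm_fix_group\<close> is a group, and the definite descriptions in
  \<^const>\<open>inner_map\<close> and \<^const>\<open>sigma\<close> are well defined.
\<close>

lemma group_perm_fix_group:
  assumes "right_loop S"
  shows "group (perm_fix_group S)"
proof (rule groupI)
  interpret right_loop S by fact
  fix h k assume "h \<in> carrier (perm_fix_group S)" "k \<in> carrier (perm_fix_group S)"
  then show "h \<otimes>\<^bsub>perm_fix_group S\<^esub> k \<in> carrier (perm_fix_group S)"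
    by (auto simp: perm_fix_group_def compose_Bij compose_eq one_closed)
next
  interpret right_loop S by fact
  show "\<one>\<^bsub>perm_fix_group S\<^esub> \<in> carrier (perm_fix_group S)"
    by (simp add: perm_fix_group_def id_Bij one_closed)
next
  fix h k l
  assume "h \<in> carrier (perm_fix_group S)" "k \<in> carrier (perm_fix_group S)"
    "l \<in> carrier (perm_fix_group S)"
  then show "h \<otimes>\<^bsub>perm_fix_group S\<^esub> k \<otimes>\<^bsub>perm_fix_group S\<^esub> l =
      h \<otimes>\<^bsub>perm_fix_group S\<^esub> (k \<otimes>\<^bsub>perm_fix_group S\<^esub> l)"
    using Bij_imp_funcset by (fastforce simp: perm_fix_group_def intro: compose_assoc)
next
  fix h assume "h \<in> carrier (perm_fix_group S)"
  then show "\<one>\<^bsub>perm_fix_group S\<^esub> \<otimes>\<^bsub>perm_fix_group S\<^esub> h = h"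
    by (auto simp: perm_fix_group_def compose_def Bij_def extensional_def)
next
  interpret right_loop S by fact
  fix h assume h: "h \<in> carrier (perm_fix_group S)"
  then have hB: "h \<in> Bij (carrier S)" and h1: "h \<one>\<^bsub>S\<^esub> = \<one>\<^bsub>S\<^esub>"
    by (auto simp: perm_fix_group_def)
  let ?k = "\<lambda>x\<in>carrier S. inv_into (carrier S) h x"
  have bij: "bij_betw h (carrier S) (carrier S)"
    using hB by (simp add: Bij_def)
  have "inv_into (carrier S) h \<one>\<^bsub>S\<^esub> = \<one>\<^bsub>S\<^esub>"
    using bij h1 one_closed by (metis bij_betw_def inv_into_f_f)
  then have "?k \<in> carrier (perm_fix_group S)"
    using restrict_inv_into_Bij[OF hB] one_closed by (simp add: perm_fix_group_def)
  moreover have "?k \<otimes>\<^bsub>perm_fix_group S\<^esub> h = \<one>\<^bsub>perm_fix_group S\<^esub>"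
    using bij by (auto simp: perm_fix_group_def compose_def fun_eq_iff bij_betw_def f_inv_into_f)
  ultimately show "\<exists>k\<in>carrier (perm_fix_group S). k \<otimes>\<^bsub>perm_fix_group S\<^esub> h = \<one>\<^bsub>perm_fix_group S\<^esub>"
    by blast
qed

context right_loop
begin

lemma bij_right_mult:
  assumes "y \<in> carrier S"
  shows "bij_betw (\<lambda>x. x \<otimes> y) (carrier S) (carrier S)"
  unfolding bij_betw_def inj_on_def image_def
  using right_div[OF assms] m_closed assms by (auto; metis)

lemma ex1_perm:
  assumes c: "c \<in> carrier S"
    and p: "bij_betw p (carrier S) (carrier S)" and p1: "p \<one> = c"
  shows "\<exists>!k. k \<in> carrier (perm_fix_group S) \<and> (\<forall>x\<in>carrier S. k x \<otimes> c = p x)"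
proof -
  define R where "R = (\<lambda>x. x \<otimes> c)"
  define k where "k = (\<lambda>x\<in>carrier S. inv_into (carrier S) R (p x))"
  have R: "bij_betw R (carrier S) (carrier S)"
    unfolding R_def by (rule bij_right_mult[OF c])
  have "bij_betw (inv_into (carrier S) R \<circ> p) (carrier S) (carrier S)"
    using bij_betw_trans[OF p bij_betw_inv_into[OF R]] .
  then have b: "bij_betw k (carrier S) (carrier S)"
    by (rule bij_betw_cong[THEN iffD1, rotated]) (simp add: k_def)
  have kx: "k x \<otimes> c = p x" if "x \<in> carrier S" for x
    using R p that bij_betwE[OF p] bij_betw_inv_into_right[OF R] by (auto simp: k_def R_def)
  have inj: "u = v" if "u \<in> carrier S" "v \<in> carrier S" "u \<otimes> c = v \<otimes> c" for u v
    using right_div[OF c] m_closed c that by metis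
  have "k \<one> = \<one>"
    using inj kx[OF one_closed] p1 l_one[OF c] one_closed bij_betwE[OF b] by metis
  then have kc: "k \<in> carrier (perm_fix_group S)"
    using b by (simp add: perm_fix_group_def Bij_def k_def)
  moreover have "h = k"
    if h: "h \<in> carrier (perm_fix_group S)" "\<forall>x\<in>carrier S. h x \<otimes> c = p x" for h
  proof (rule extensionalityI[of _ "carrier S"])
    show "h \<in> extensional (carrier S)" "k \<in> extensional (carrier S)"
      using h kc by (auto simp: perm_fix_group_def Bij_def)
    fix x assume x: "x \<in> carrier S"
    have "h x \<in> carrier S"
      using h(1) x by (auto simp: perm_fix_group_def Bij_def dest: bij_betwE)
    then show "h x = k x"
      using inj x h(2) kx bij_betwE[OF b] by metis
  qed
  ultimately show ?thesis
    using kx by blast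
qed

lemma inner_map_ex1:
  assumes y: "y \<in> carrier S" and z: "z \<in> carrier S"
  shows "\<exists>!h. h \<in> carrier (perm_fix_group S) \<and>
    (\<forall>x\<in>carrier S. h x \<otimes> (y \<otimes> z) = (x \<otimes> y) \<otimes> z)"
proof (rule ex1_perm)
  show "bij_betw (\<lambda>x. (x \<otimes> y) \<otimes> z) (carrier S) (carrier S)"
    using bij_betw_trans[OF bij_right_mult[OF y] bij_right_mult[OF z]] by (simp add: comp_def)
qed (use y z m_closed l_one in auto)

lemma sigma_ex1:
  assumes y: "y \<in> carrier S" and h: "h \<in> carrier (perm_fix_group S)"
  shows "\<exists>!k. k \<in> carrier (perm_fix_group S) \<and>
    (\<forall>x\<in>carrier S. h (x \<otimes> y) = k x \<otimes> h y)"
proof -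
  have b: "bij_betw h (carrier S) (carrier S)"
    using h by (auto simp: perm_fix_group_def Bij_def)
  have "\<exists>!k. k \<in> carrier (perm_fix_group S) \<and> (\<forall>x\<in>carrier S. k x \<otimes> h y = h (x \<otimes> y))"
  proof (rule ex1_perm)
    show "bij_betw (\<lambda>x. h (x \<otimes> y)) (carrier S) (carrier S)"
      using bij_betw_trans[OF bij_right_mult[OF y] b] by (simp add: comp_def)
  qed (use y l_one bij_betwE[OF b] in auto)
  then show ?thesis by (simp add: eq_commute)
qed

end

end

(* The group element (a, x) acts on S by u \<mapsto> (u \<theta> a) \<circ> x, and the product of the general extension
   is made so that it corresponds to composition of these maps. Hence (g^r, \<beta>^r) acts as the r-th
   iterate of T u = (u \<theta> a) \<circ> x; evaluating at e gives \<beta>^r = T^r e, and both keys are T^(m+n) e. *)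
theory Submission
  imports Defs
begin

context right_loop
begin

lemma perm_fix_closed:
  "\<lbrakk>h \<in> carrier (perm_fix_group S); u \<in> carrier S\<rbrakk> \<Longrightarrow> h u \<in> carrier S"
  by (auto simp: perm_fix_group_def Bij_def dest: bij_betwE)

lemma perm_fix_one: "h \<in> carrier (perm_fix_group S) \<Longrightarrow> h \<one> = \<one>"
  by (simp add: perm_fix_group_def)

lemma perm_fix_mult:
  "u \<in> carrier S \<Longrightarrow> (h \<otimes>\<^bsub>perm_fix_group S\<^esub> k) u = k (h u)"
  by (simp add: perm_fix_group_def compose_eq)

lemma inner_map_carrier:
  "\<lbrakk>y \<in> carrier S; z \<in> carrier S\<rbrakk> \<Longrightarrow> inner_map S y z \<in> carrier (perm_fix_group S)"
  unfolding inner_map_def using theI'[OF inner_map_ex1] by blast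

lemma inner_map_mult:
  "\<lbrakk>x \<in> carrier S; y \<in> carrier S; z \<in> carrier S\<rbrakk>
    \<Longrightarrow> inner_map S y z x \<otimes> (y \<otimes> z) = (x \<otimes> y) \<otimes> z"
  unfolding inner_map_def using theI'[OF inner_map_ex1] by blast

lemma sigma_carrier:
  "\<lbrakk>y \<in> carrier S; h \<in> carrier (perm_fix_group S)\<rbrakk> \<Longrightarrow> sigma S y h \<in> carrier (perm_fix_group S)"
  unfolding sigma_def using theI'[OF sigma_ex1] by blast

lemma sigma_mult:
  "\<lbrakk>x \<in> carrier S; y \<in> carrier S; h \<in> carrier (perm_fix_group S)\<rbrakk>
    \<Longrightarrow> sigma S y h x \<otimes> h y = h (x \<otimes> y)"
  unfolding sigma_def using theI'[OF sigma_ex1] by simp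

text \<open>Both (x \<otimes> \<open>\<one>\<close>) \<otimes> z and x \<otimes>
  (\<open>\<one>\<close> \<otimes> z) are x \<otimes> z, so the identity map meets the description.
  With \<open>sigma_one\<close> this lets powers in the general extension start correctly: its unit
  times (a, x) is (a, x).\<close>

lemma inner_map_one:
  assumes "z \<in> carrier S"
  shows "inner_map S \<one> z = \<one>\<^bsub>perm_fix_group S\<^esub>"
  unfolding inner_map_def
proof (rule the1_equality[OF inner_map_ex1[OF one_closed assms]])
  show "\<one>\<^bsub>perm_fix_group S\<^esub> \<in> carrier (perm_fix_group S) \<and>
    (\<forall>x\<in>carrier S. \<one>\<^bsub>perm_fix_group S\<^esub> x \<otimes> (\<one> \<otimes> z) = (x \<otimes> \<one>) \<otimes> z)"
    using assms by (auto simp: perm_fix_group_def id_Bij one_closed l_one r_one)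
qed

lemma sigma_one:
  assumes "h \<in> carrier (perm_fix_group S)"
  shows "sigma S \<one> h = h"
  unfolding sigma_def
  by (rule the1_equality[OF sigma_ex1[OF one_closed assms]])
    (use assms in \<open>simp add: perm_fix_one perm_fix_closed r_one\<close>)

text \<open>Carries the lemmas below, stated for all permutations fixing \<open>\<one>\<close>, over
  to elements of the group torsion.\<close>

lemma group_torsion_subset: "group_torsion S \<subseteq> carrier (perm_fix_group S)"
  unfolding group_torsion_def
  by (rule group.generate_incl[OF group_perm_fix_group[OF right_loop_axioms]])
    (auto intro: inner_map_carrier)

text \<open>The point where the product of the general extension becomes composition: acting by (g,
  y) and then by (b, x). The identity of \<open>inner_map\<close> turns the left side into
  (\<open>sigma S y b (g u)\<close> \<otimes> b y) \<otimes> x, and that of \<open>sigma\<close>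
  collapses the bracket to b (g u \<otimes> y).\<close>

lemma mult_action:
  assumes "g \<in> carrier (perm_fix_group S)" "b \<in> carrier (perm_fix_group S)"
    and "u \<in> carrier S" "y \<in> carrier S" "x \<in> carrier S"
  shows "(g \<otimes>\<^bsub>perm_fix_group S\<^esub> sigma S y b \<otimes>\<^bsub>perm_fix_group S\<^esub> inner_map S (b y) x) u
    \<otimes> (b y \<otimes> x) = b (g u \<otimes> y) \<otimes> x"
  using assms
  by (simp add: perm_fix_mult inner_map_mult sigma_mult perm_fix_closed sigma_carrier)

lemma gseq_beta_carrier:
  assumes "a \<in> carrier (perm_fix_group S)" "x \<in> carrier S"
  shows "gseq S (Suc r) x a \<in> carrier (perm_fix_group S) \<and> beta S (Suc r) x a \<in> carrier S"
proof -
  interpret P: group "perm_fix_group S"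
    by (rule group_perm_fix_group[OF right_loop_axioms])
  show ?thesis
    using assms
    by (induction r) (simp_all add: m_closed perm_fix_closed sigma_carrier inner_map_carrier)
qed

text \<open>By induction on r: the recursions append one factor (a, x) on the right, so
  \<open>mult_action\<close> with b = a applies the map once more, on the outside.\<close>

lemma gseq_action:
  assumes "a \<in> carrier (perm_fix_group S)" "x \<in> carrier S" "u \<in> carrier S"
  shows "gseq S (Suc r) x a u \<otimes> beta S (Suc r) x a = ((\<lambda>u. a u \<otimes> x) ^^ Suc r) u"
proof (induction r)
  case (Suc r)
  then show ?case
    using assms gseq_beta_carrier[OF assms(1,2), of r] by (simp add: mult_action)
qed simp

text \<open>Evaluates \<open>gseq_action\<close> at \<open>\<one>\<close>, which every
  \<open>gseq\<close> fixes.\<close>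

lemma beta_eq_funpow:
  assumes "a \<in> carrier (perm_fix_group S)" "x \<in> carrier S"
  shows "beta S (Suc r) x a = ((\<lambda>u. a u \<otimes> x) ^^ Suc r) \<one>"
  using gseq_action[OF assms one_closed, of r] gseq_beta_carrier[OF assms, of r]
  by (simp add: perm_fix_one l_one)

text \<open>The argument \<open>beta S (Suc l) x a\<close> is itself an iterate at
  \<open>\<one>\<close>, so acting on it with the pair of index \<open>Suc k\<close> adds the
  exponents.\<close>

lemma key_eq_funpow:
  assumes "a \<in> carrier (perm_fix_group S)" "x \<in> carrier S"
  shows "gseq S (Suc k) x a (beta S (Suc l) x a) \<otimes> beta S (Suc k) x a
    = ((\<lambda>u. a u \<otimes> x) ^^ (Suc k + Suc l)) \<one>"
  using gseq_action[OF assms, of "beta S (Suc l) x a" k] gseq_beta_carrier[OF assms, of l]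
  by (simp only: funpow_add comp_apply beta_eq_funpow[OF assms, of l])

lemma general_extension_pow:
  assumes a: "a \<in> carrier (perm_fix_group S)" and x: "x \<in> carrier S"
  shows "(a, x) [^]\<^bsub>general_extension S\<^esub> Suc r = (gseq S (Suc r) x a, beta S (Suc r) x a)"
proof (induction r)
  case 0
  interpret P: group "perm_fix_group S"
    by (rule group_perm_fix_group[OF right_loop_axioms])
  show ?case
    using a x
    by (simp add: nat_pow_def general_extension_def sigma_one inner_map_one perm_fix_one l_one)
next
  case (Suc r)
  then show ?case
    \<comment> \<open>The first \<open>simp\<close> rewrites the inner power by the induction
      hypothesis while the product is still folded; unfolding the product then gives exactly the
      recursions of \<open>gseq\<close> and \<open>beta\<close>.\<close>
    by (simp add: nat_pow_def) (simp add: general_extension_def)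
qed

end

theorem mainTheorem2:
  fixes S :: "('a, 'b) monoid_scheme" (structure)
    and x :: 'a and a :: "'a \<Rightarrow> 'a" and m n :: nat
  assumes "right_loop S"
    and "x \<in> carrier S - {\<one>}"
    and "a \<in> group_torsion S - {\<one>\<^bsub>perm_fix_group S\<^esub>}"
    and "m \<ge> 1" and "n \<ge> 1"
  shows "(\<forall>r\<ge>1. (a, x) [^]\<^bsub>general_extension S\<^esub> r = (gseq S r x a, beta S r x a))
    \<and> gseq S m x a (beta S n x a) \<otimes> beta S m x a
      = gseq S n x a (beta S m x a) \<otimes> beta S n x a"
proof -
  interpret right_loop S by fact
  have a: "a \<in> carrier (perm_fix_group S)" and x: "x \<in> carrier S"
    using assms group_torsion_subset by auto
  obtain k l where "m = Suc k" "n = Suc l"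
    using assms by (cases m; cases n) auto
  then have "gseq S m x a (beta S n x a) \<otimes> beta S m x a
      = gseq S n x a (beta S m x a) \<otimes> beta S n x a"
    \<comment> \<open>Exchanging k and l only swaps the summands of the exponent, so both keys are
      the same iterate.\<close>
    using key_eq_funpow[OF a x, of k l] key_eq_funpow[OF a x, of l k]
    by (simp only: add.commute)
  moreover have "(a, x) [^]\<^bsub>general_extension S\<^esub> r = (gseq S r x a, beta S r x a)"
    if "r \<ge> 1" for r
    using that general_extension_pow[OF a x, of "r - 1"] by simp
  ultimately show ?thesis by blast
qed

end
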